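(* Let $\mathbb Q$ be a probability distribution on $\mathcal S=\mathbb R^d\times[-L,L]$, $L>0$, let $\mathcal B_{\mathcal S}$ be the Borel $\sigma$-algebra of $\mathcal S$, and let $\mathbb Q_n$ be the empirical measure of an i.i.d. sample of size $n$ from $\mathbb Q$. Let $\mathcal B\subseteq\mathcal B_{\mathcal S}$ and let $\mathcal F_{\mathcal B}:=\{f\mathbf 1_A:f\in\mathcal F,\ A\in\mathcal B\}$, where $\mathcal F$ is a uniformly bounded set of functions in $L^1(\mathbb Q)$. If $\mathcal B$ and $\mathcal F_{\mathcal B}$ are $\mathbb Q$-Donsker classes, then for any $\alpha\in[0,1/2)$, with $\mathcal B_n:=\{A\in\mathcal B:\mathbb Q_n(A)\ge n^{-\alpha}\}$, $$\sup_{f\in\mathcal F}\ \sup_{A\in\mathcal B_n}\big|\mathbb E_n[f\mid A]-\mathbb E[f\mid A]\big|=O_{\mathbb P^*}(n^{\alpha-1/2}).$$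
   Context: Here $\mathbb E_n[f\mid A]=\frac{\int_A f\,d\mathbb Q_n}{\mathbb Q_n(A)}$ and $\mathbb E[f\mid A]=\frac{\int_A f\,d\mathbb Q}{\mathbb Q(A)}$ (taken to be $0$ if $\mathbb Q(A)=0$). A supremum over an empty set is $0$. Uniformly bounded means $\sup_{f\in\mathcal F,\,s\in\mathcal S}|f(s)|<\infty$. A class $\mathcal G$ of functions in $L^1(\mathbb Q)$ on $\mathcal S$ is $\mathbb Q$-Donsker if the empirical process $\{\sqrt n(\int f\,d\mathbb Q_n-\int f\,d\mathbb Q):f\in\mathcal G\}$ converges in distribution in $\ell^\infty(\mathcal G)$ to a tight limit process (in the Hoffmann-Jørgensen sense with outer probabilities). A class $\mathcal B$ of Borel sets is $\mathbb Q$-Donsker if $\{\mathbf 1_A:A\in\mathcal B\}$ is a $\mathbb Q$-Donsker class of functions. The sample is defined on a probability space $(\Omega,\mathcal A,\mathbb P)$; the outer probability is $\mathbb P^*(A)=\inf\{\mathbb P(\tilde A):A\subseteq\tilde A,\ \tilde A\in\mathcal A\}$ for $A\subseteq\Omega$. For real-valued maps $M_n$ on $\Omega$ (not necessarily measurable) and $a_n>0$, $M_n=O_{\mathbb P^*}(a_n)$ means that $M_n/a_n$ is asymptotically tight: for every $\varepsilon>0$ there is $K>0$ with $\limsup_{n\to\infty}\mathbb P^*(|M_n|/a_n>K)<\varepsilon$. *)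

theory Defs
  imports "HOL-Probability.Probability"
begin

text \<open>
  Throughout, \<open>Q\<close> is a probability measure with \<open>space Q\<close> the sample space \<open>S\<close>, and the sample is an
  infinite sequence \<open>X 0, X 1, \<dots>\<close> on a probability space \<open>P\<close>, of which the empirical measure of
  size \<open>n\<close> uses \<open>X 0, \<dots>, X (n - 1)\<close>. Functions on \<open>S\<close> are total HOL functions; their values
  outside \<open>space Q\<close> never matter.
\<close>

definition iid_sample :: "'w measure \<Rightarrow> 's measure \<Rightarrow> (nat \<Rightarrow> 'w \<Rightarrow> 's) \<Rightarrow> bool" where
  "iid_sample P Q X \<longleftrightarrow>
     prob_space.indep_vars P (\<lambda>_. Q) X UNIV \<and> (\<forall>i. distr P Q (X i) = Q)"

text \<open>\<open>(1/n) \<Sum>\<^sub>i \<delta>(X i \<omega>)\<close>, as the law of \<open>X I \<omega>\<close> for \<open>I\<close> uniform on \<open>{0, \<dots>, n - 1}\<close>;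
  see the two lemmas below. For \<open>n = 0\<close> it is the zero measure.\<close>

definition empirical_measure ::
    "'s measure \<Rightarrow> (nat \<Rightarrow> 'w \<Rightarrow> 's) \<Rightarrow> nat \<Rightarrow> 'w \<Rightarrow> 's measure" where
  "empirical_measure Q X n \<omega> = distr (uniform_count_measure {..<n}) Q (\<lambda>i. X i \<omega>)"

lemma measure_empirical_measure:
  assumes "\<And>i. i < n \<Longrightarrow> X i \<omega> \<in> space Q" and "A \<in> sets Q"
  shows "measure (empirical_measure Q X n \<omega>) A = real (card {i. i < n \<and> X i \<omega> \<in> A}) / real n"
proof -
  have "(\<lambda>i. X i \<omega>) \<in> measurable (uniform_count_measure {..<n}) Q"
    using assms(1) by (auto simp: measurable_def space_uniform_count_measure sets_uniform_count_measure)
  moreover have "{i. i < n \<and> X i \<omega> \<in> A} \<subseteq> {..<n}"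
    by auto
  moreover have "(\<lambda>i. X i \<omega>) -` A \<inter> {..<n} = {i. i < n \<and> X i \<omega> \<in> A}"
    by auto
  ultimately show ?thesis
    using assms(2)
    by (simp add: empirical_measure_def measure_distr space_uniform_count_measure
        measure_uniform_count_measure)
qed

lemma integral_empirical_measure:
  fixes f :: "'s \<Rightarrow> real"
  assumes "\<And>i. i < n \<Longrightarrow> X i \<omega> \<in> space Q" and "f \<in> borel_measurable Q"
  shows "(LINT s|empirical_measure Q X n \<omega>. f s) = (\<Sum>i<n. f (X i \<omega>)) / real n"
proof -
  have "(\<lambda>i. X i \<omega>) \<in> measurable (uniform_count_measure {..<n}) Q"
    using assms(1) by (auto simp: measurable_def space_uniform_count_measure sets_uniform_count_measure)
  then show ?thesis
    using assms(2)
    by (simp add: empirical_measure_def integral_distr integral_uniform_count_measure)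
qed

definition cond_mean :: "'s measure \<Rightarrow> ('s \<Rightarrow> real) \<Rightarrow> 's set \<Rightarrow> real" where
  "cond_mean M f A =
     (if measure M A = 0 then 0 else (LINT s:A|M. f s) / measure M A)"

definition empirical_process ::
    "'s measure \<Rightarrow> (nat \<Rightarrow> 'w \<Rightarrow> 's) \<Rightarrow> nat \<Rightarrow> 'w \<Rightarrow> ('s \<Rightarrow> real) \<Rightarrow> real" where
  "empirical_process Q X n \<omega> f =
     sqrt (real n) * ((LINT s|empirical_measure Q X n \<omega>. f s) - (LINT s|Q. f s))"

text \<open>The space \<open>\<ell>\<^sup>\<infinity>(I)\<close> of bounded real functions on \<open>I\<close> with the supremum metric
  (elements are \<open>undefined\<close> off \<open>I\<close>).\<close>

abbreviation ell_infty :: "'i set \<Rightarrow> ('i \<Rightarrow> real) metric" where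
  "ell_infty I \<equiv> funspace I euclidean_metric"

definition borel_of_metric :: "'a metric \<Rightarrow> 'a measure" where
  "borel_of_metric m = sigma (mspace m) {U. openin (mtopology_of m) U}"

text \<open>Outer expectation. Only used for bounded \<open>T\<close>; for such \<open>T\<close>, allowing extended-real measurable
  majorants \<open>U\<close> whose expectation exists would give the same infimum (replace \<open>U\<close> by its minimum
  with an upper bound of \<open>T\<close>).\<close>

definition outer_expectation :: "'w measure \<Rightarrow> ('w \<Rightarrow> real) \<Rightarrow> real" where
  "outer_expectation P T =
     Inf {(LINT \<omega>|P. U \<omega>) | U. integrable P U \<and> (\<forall>\<omega>\<in>space P. T \<omega> \<le> U \<omega>)}"

definition tight_borel_prob :: "'a metric \<Rightarrow> 'a measure \<Rightarrow> bool" where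
  "tight_borel_prob m \<nu> \<longleftrightarrow>
     prob_space \<nu> \<and> space \<nu> = mspace m \<and> sets \<nu> = sets (borel_of_metric m) \<and>
     (\<forall>\<epsilon>>0. \<exists>K. compactin (mtopology_of m) K \<and> measure \<nu> K > 1 - \<epsilon>)"

text \<open>Convergence in distribution in the sense of Hoffmann-Joergensen of arbitrary maps
  \<open>Z n : space P \<rightarrow> mspace m\<close>, to a limit with law \<open>\<nu>\<close>.\<close>

definition converges_in_distr_HJ ::
    "'w measure \<Rightarrow> 'a metric \<Rightarrow> (nat \<Rightarrow> 'w \<Rightarrow> 'a) \<Rightarrow> 'a measure \<Rightarrow> bool" where
  "converges_in_distr_HJ P m Z \<nu> \<longleftrightarrow>
     (\<forall>n. \<forall>\<omega>\<in>space P. Z n \<omega> \<in> mspace m) \<and>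
     (\<forall>h. continuous_map (mtopology_of m) euclideanreal h \<and> bounded (h ` mspace m) \<longrightarrow>
        (\<lambda>n. outer_expectation P (\<lambda>\<omega>. h (Z n \<omega>))) \<longlonglongrightarrow> (LINT z|\<nu>. h z))"

text \<open>The Donsker property is a property of the empirical process of the sample \<open>X\<close> on \<open>P\<close> at hand.
  It is implied by the same property for the coordinate sample on the infinite product of \<open>Q\<close>.\<close>

definition donsker ::
    "'w measure \<Rightarrow> (nat \<Rightarrow> 'w \<Rightarrow> 's) \<Rightarrow> 's measure \<Rightarrow> ('s \<Rightarrow> real) set \<Rightarrow> bool" where
  "donsker P X Q G \<longleftrightarrow>
     (\<forall>f\<in>G. integrable Q f) \<and>
     (\<exists>\<nu>. tight_borel_prob (ell_infty G) \<nu> \<and>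
          converges_in_distr_HJ P (ell_infty G)
            (\<lambda>n \<omega>. restrict (empirical_process Q X n \<omega>) G) \<nu>)"

definition donsker_sets ::
    "'w measure \<Rightarrow> (nat \<Rightarrow> 'w \<Rightarrow> 's) \<Rightarrow> 's measure \<Rightarrow> 's set set \<Rightarrow> bool" where
  "donsker_sets P X Q B \<longleftrightarrow> donsker P X Q ((\<lambda>A. indicator A) ` B)"

definition uniformly_bounded_on :: "'s set \<Rightarrow> ('s \<Rightarrow> real) set \<Rightarrow> bool" where
  "uniformly_bounded_on S F \<longleftrightarrow> (\<exists>C. \<forall>f\<in>F. \<forall>s\<in>S. \<bar>f s\<bar> \<le> C)"

definition restricted_class :: "('s \<Rightarrow> real) set \<Rightarrow> 's set set \<Rightarrow> ('s \<Rightarrow> real) set" where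
  "restricted_class F B = {(\<lambda>s. f s * indicator A s) | f A. f \<in> F \<and> A \<in> B}"

text \<open>Supremum with the convention that the supremum of the empty set is 0
  (\<open>Sup\<close> on \<^typ>\<open>real\<close> does not fix that value).\<close>

definition sup0 :: "real set \<Rightarrow> real" where
  "sup0 Y = (if Y = {} then 0 else Sup Y)"

text \<open>\<open>M n = O\<^sub>P\<^sub>*(a n)\<close> for maps \<open>M n\<close> that need not be measurable.\<close>

definition bigO_outer_prob ::
    "'w measure \<Rightarrow> (nat \<Rightarrow> 'w \<Rightarrow> real) \<Rightarrow> (nat \<Rightarrow> real) \<Rightarrow> bool" where
  "bigO_outer_prob P M a \<longleftrightarrow>
     (\<forall>\<epsilon>::real. \<epsilon> > 0 \<longrightarrow> (\<exists>K>0.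
        limsup (\<lambda>n. outer_measure_of P {\<omega> \<in> space P. \<bar>M n \<omega>\<bar> / a n > K}) < ennreal \<epsilon>))"

end

theory Submission
  imports Defs
begin

text \<open>
  Weak convergence in \<open>\<ell>\<^sup>\<infinity>(G)\<close> makes the suprema of the empirical process over \<open>G\<close>
  bounded in outer probability: test it against the bounded continuous functions
  \<open>z \<mapsto> min 1 (max 0 (\<parallel>z\<parallel> - k))\<close>. On the event that both empirical processes are bounded by \<open>K\<close>,
  the claim follows from the decomposition
  \<open>E\<^sub>n[f|A] - E[f|A] = ((Q\<^sub>n - Q)(f 1\<^sub>A) - E[f|A] (Q\<^sub>n - Q)(A)) / Q\<^sub>n(A)\<close>
  with \<open>Q\<^sub>n(A) \<ge> n\<^sup>-\<^sup>\<alpha>\<close> and \<open>\<bar>E[f|A]\<bar> \<le> C\<close>.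
\<close>

section \<open>Subadditivity of outer measure and a Markov inequality for outer expectation\<close>

text \<open>Subsets of the space have measurable covers of the same measure, and ordinary
  subadditivity applies to these covers.\<close>

lemma outer_measure_of_Un_le:
  "outer_measure_of M (A \<union> B) \<le> outer_measure_of M A + outer_measure_of M B"
proof (cases "A \<subseteq> space M \<and> B \<subseteq> space M")
  case True
  then obtain E F where "E \<in> sets M" "A \<subseteq> E" "outer_measure_of M A = emeasure M E"
    and "F \<in> sets M" "B \<subseteq> F" "outer_measure_of M B = emeasure M F"
    using outer_measure_of_attain[of A M] outer_measure_of_attain[of B M] by blast
  moreover have "outer_measure_of M (A \<union> B) \<le> outer_measure_of M (E \<union> F)"
    using \<open>A \<subseteq> E\<close> \<open>B \<subseteq> F\<close> by (intro outer_measure_of_mono) auto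
  ultimately show ?thesis
    using emeasure_subadditive[of E M F] by (simp add: sets.Un)
next
  case False
  \<comment> \<open>A set that leaves the space has no measurable cover, so its outer measure is an
    infimum over the empty set.\<close>
  have top: "outer_measure_of M C = \<infinity>" if "\<not> C \<subseteq> space M" for C
  proof -
    have "{D \<in> sets M. C \<subseteq> D} = {}"
      using that sets.sets_into_space by blast
    then show ?thesis
      unfolding outer_measure_of_def by (simp only: image_empty Inf_empty infinity_ennreal_def)
  qed
  from False have "outer_measure_of M A = \<infinity> \<or> outer_measure_of M B = \<infinity>"
    using top by blast
  then show ?thesis
    by auto
qed

text \<open>Every integrable majorant \<open>U\<close> of \<open>T\<close> is nonnegative and its
  measurable level set \<open>U \<ge> 1\<close> contains that of \<open>T\<close>; the usual Markov
  inequality for \<open>U\<close> is followed by the infimum over \<open>U\<close>.\<close>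

lemma outer_Markov_inequality:
  assumes "prob_space P" and nonneg: "\<And>\<omega>. \<omega> \<in> space P \<Longrightarrow> 0 \<le> T \<omega>"
    and bounded: "\<And>\<omega>. \<omega> \<in> space P \<Longrightarrow> T \<omega> \<le> c"
  shows "outer_measure_of P {\<omega> \<in> space P. T \<omega> \<ge> 1} \<le> ennreal (outer_expectation P T)"
proof -
  interpret prob_space P by fact
  define S where "S = {\<omega> \<in> space P. T \<omega> \<ge> 1}"
  have "outer_measure_of P S \<le> outer_measure_of P (space P)"
    by (intro outer_measure_of_mono) (auto simp: S_def)
  \<comment> \<open>Finiteness allows the bound to be proved for real numbers, where
    \<open>Inf\<close> is taken, and then carried back to \<open>ennreal\<close>.\<close>
  then have fin: "outer_measure_of P S < top"
    by (simp add: emeasure_space_1 order_le_less_trans)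
  have "enn2real (outer_measure_of P S) \<le> outer_expectation P T"
    unfolding outer_expectation_def
  proof (rule cInf_greatest)
    \<comment> \<open>The constant \<open>c\<close> is a majorant, so the real infimum is not the
      unspecified one over the empty set.\<close>
    have "integrable P (\<lambda>_. c) \<and> (\<forall>\<omega>\<in>space P. T \<omega> \<le> c)"
      using bounded by simp
    then show "{LINT \<omega>|P. U \<omega> | U. integrable P U \<and> (\<forall>\<omega>\<in>space P. T \<omega> \<le> U \<omega>)} \<noteq> {}"
      by blast
  next
    fix x assume "x \<in> {LINT \<omega>|P. U \<omega> | U. integrable P U \<and> (\<forall>\<omega>\<in>space P. T \<omega> \<le> U \<omega>)}"
    then obtain U where x: "x = (LINT \<omega>|P. U \<omega>)" and [measurable]: "integrable P U"
      and TU: "\<And>\<omega>. \<omega> \<in> space P \<Longrightarrow> T \<omega> \<le> U \<omega>"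
      by blast
    have U0: "0 \<le> U \<omega>" if "\<omega> \<in> space P" for \<omega>
      using nonneg TU that order_trans by blast
    have sub: "S \<subseteq> {\<omega> \<in> space P. U \<omega> \<ge> 1}"
      using TU by (force simp: S_def)
    have level: "{\<omega> \<in> space P. U \<omega> \<ge> 1} \<in> sets P"
      by measurable
    have "outer_measure_of P S \<le> emeasure P {\<omega> \<in> space P. U \<omega> \<ge> 1}"
      using outer_measure_of_mono[OF sub, of P] by (simp only: outer_measure_of_eq[OF level])
    also have "\<dots> \<le> ennreal x"
      using integral_Markov_inequality[of P U 1] \<open>integrable P U\<close> U0 by (simp add: x)
    finally have "outer_measure_of P S \<le> ennreal x" .
    moreover have "0 \<le> x"
      unfolding x using U0 by (intro integral_nonneg_AE) auto
    ultimately show "enn2real (outer_measure_of P S) \<le> x"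
      using enn2real_leI by blast
  qed
  then have "ennreal (enn2real (outer_measure_of P S)) \<le> ennreal (outer_expectation P T)"
    by (rule ennreal_leI)
  then show ?thesis
    using fin by (simp add: S_def)
qed

section \<open>From weak convergence to boundedness in outer probability\<close>

lemma continuous_map_borel_measurable:
  fixes h :: "'a \<Rightarrow> real"
  assumes "continuous_map (mtopology_of m) euclideanreal h"
    and "space N = mspace m" and "sets N = sets (borel_of_metric m)"
  shows "h \<in> borel_measurable N"
proof (rule borel_measurableI)
  fix S :: "real set" assume "open S"
  have sub: "{U. openin (mtopology_of m) U} \<subseteq> Pow (mspace m)"
    using openin_subset[of "mtopology_of m"] by auto
  have "openin (mtopology_of m) {x \<in> mspace m. h x \<in> S}"
    using openin_continuous_map_preimage[OF assms(1), of S] \<open>open S\<close> by simp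
  moreover have "h -` S \<inter> space N = {x \<in> mspace m. h x \<in> S}"
    using assms(2) by auto
  ultimately show "h -` S \<inter> space N \<in> sets N"
    using sub by (simp add: assms(3) borel_of_metric_def)
qed

text \<open>The limit law gives little mass to the outside of large balls around \<open>a\<close>. A
  continuous cutoff makes this a statement about test functions, which convergence transfers to
  outer expectations and the outer Markov inequality to outer probabilities.\<close>

lemma converges_in_distr_HJ_bounded_in_outer_prob:
  assumes "prob_space P" and tight: "tight_borel_prob m \<nu>"
    and conv: "converges_in_distr_HJ P m Z \<nu>"
    and a: "a \<in> mspace m" and "0 < \<epsilon>"
  shows "\<exists>K>0. \<forall>\<^sub>F n in sequentially.
           outer_measure_of P {\<omega> \<in> space P. mdist m (Z n \<omega>) a > K} \<le> ennreal \<epsilon>"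
proof -
  interpret \<nu>: prob_space \<nu>
    using tight by (simp add: tight_borel_prob_def)
  \<comment> \<open>A continuous substitute for a tail indicator: 0 up to distance \<open>k\<close>
    from \<open>a\<close>, and 1 from distance \<open>k + 1\<close> on.\<close>
  define h where "h k z = min 1 (max 0 (mdist m z a - real k))" for k :: nat and z
  have cont: "continuous_map (mtopology_of m) euclideanreal (h k)" for k
    unfolding h_def using a
    by (intro continuous_map_real_min continuous_map_real_max continuous_map_diff
        continuous_map_mdist continuous_map_canonical_const continuous_map_id[unfolded id_def])
      auto
  have h_meas: "h k \<in> borel_measurable \<nu>" for k
    using continuous_map_borel_measurable[OF cont] tight by (simp add: tight_borel_prob_def)
  have h01: "0 \<le> h k z" "h k z \<le> 1" for k z
    by (auto simp: h_def)
  have "(\<lambda>k. LINT z|\<nu>. h k z) \<longlonglongrightarrow> (LINT z|\<nu>. 0)"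
  proof (rule integral_dominated_convergence[where w = "\<lambda>_. 1"])
    show "AE z in \<nu>. (\<lambda>k. h k z) \<longlonglongrightarrow> 0"
    proof (intro AE_I2 tendsto_eventually eventually_sequentiallyI)
      \<comment> \<open>Each point lies at a finite distance from \<open>a\<close>, so the cutoff
        vanishes there for all large \<open>k\<close>.\<close>
      fix z k assume "nat \<lceil>mdist m z a\<rceil> \<le> k"
      then have "mdist m z a \<le> real k" by linarith
      then show "h k z = 0" by (simp add: h_def)
    qed
  qed (use h_meas h01 in auto)
  then have "\<forall>\<^sub>F k in sequentially. (LINT z|\<nu>. h k z) < \<epsilon>"
    using \<open>0 < \<epsilon>\<close> by (auto dest: order_tendstoD(2))
  then obtain k where k: "(LINT z|\<nu>. h k z) < \<epsilon>"
    using eventually_happens'[OF sequentially_bot] by blast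
  have "bounded (h k ` mspace m)"
    using h01 by (intro boundedI[where B = 1]) (auto simp: abs_le_iff intro: order_trans[of _ 0])
  then have "(\<lambda>n. outer_expectation P (\<lambda>\<omega>. h k (Z n \<omega>))) \<longlonglongrightarrow> (LINT z|\<nu>. h k z)"
    using conv cont by (simp add: converges_in_distr_HJ_def)
  then have "\<forall>\<^sub>F n in sequentially. outer_expectation P (\<lambda>\<omega>. h k (Z n \<omega>)) < \<epsilon>"
    using k by (rule order_tendstoD(2))
  \<comment> \<open>The radius is \<open>k + 1\<close> because the cutoff has reached 1 there, as
    the Markov step requires.\<close>
  then have "\<forall>\<^sub>F n in sequentially.
      outer_measure_of P {\<omega> \<in> space P. mdist m (Z n \<omega>) a > real k + 1} \<le> ennreal \<epsilon>"
  proof eventually_elim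
    case (elim n)
    have "outer_measure_of P {\<omega> \<in> space P. mdist m (Z n \<omega>) a > real k + 1}
        \<le> outer_measure_of P {\<omega> \<in> space P. h k (Z n \<omega>) \<ge> 1}"
      by (intro outer_measure_of_mono) (auto simp: h_def)
    also have "\<dots> \<le> ennreal (outer_expectation P (\<lambda>\<omega>. h k (Z n \<omega>)))"
      using h01 by (intro outer_Markov_inequality[OF \<open>prob_space P\<close>]) auto
    also have "\<dots> \<le> ennreal \<epsilon>"
      using elim by (intro ennreal_leI) auto
    finally show ?case .
  qed
  then show ?thesis
    by (intro exI[of _ "real k + 1"]) auto
qed

text \<open>The previous lemma is used with the zero function as centre; the supremum distance to
  zero dominates every coordinate. Writing the event with an existential avoids a supremum over a
  possibly empty \<open>G\<close>.\<close>

lemma donsker_bounded_in_outer_prob: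
  assumes "prob_space P" and "donsker P X Q G" and "0 < \<epsilon>"
  shows "\<exists>K>0. \<forall>\<^sub>F n in sequentially.
           outer_measure_of P {\<omega> \<in> space P. \<exists>g\<in>G. \<bar>empirical_process Q X n \<omega> g\<bar> > K} \<le> ennreal \<epsilon>"
proof -
  let ?Z = "\<lambda>n \<omega>. restrict (empirical_process Q X n \<omega>) G"
  let ?zero = "restrict (\<lambda>_. 0) G :: _ \<Rightarrow> real"
  obtain \<nu> where \<nu>: "tight_borel_prob (ell_infty G) \<nu>"
    "converges_in_distr_HJ P (ell_infty G) ?Z \<nu>"
    using assms(2) unfolding donsker_def by blast
  have "bounded (?zero ` G)"
    by (rule bounded_subset[of "{0}"]) auto
  then have zero: "?zero \<in> mspace (ell_infty G)"
    by (simp add: Met_TC.fspace_def)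
  obtain K where K: "K > 0" "\<forall>\<^sub>F n in sequentially. outer_measure_of P
      {\<omega> \<in> space P. mdist (ell_infty G) (?Z n \<omega>) ?zero > K} \<le> ennreal \<epsilon>"
    using converges_in_distr_HJ_bounded_in_outer_prob[OF assms(1) \<nu> zero \<open>0 < \<epsilon>\<close>] by blast
  have "{\<omega> \<in> space P. \<exists>g\<in>G. \<bar>empirical_process Q X n \<omega> g\<bar> > K}
      \<subseteq> {\<omega> \<in> space P. mdist (ell_infty G) (?Z n \<omega>) ?zero > K}" for n
  proof safe
    fix \<omega> g assume \<omega>: "\<omega> \<in> space P" and g: "g \<in> G" "\<bar>empirical_process Q X n \<omega> g\<bar> > K"
    have "?Z n \<omega> \<in> mspace (ell_infty G)"
      using \<nu>(2) \<omega> by (simp add: converges_in_distr_HJ_def)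
    \<comment> \<open>The supremum distance itself is taken as the bound in
      \<open>funspace_mdist_le\<close>; \<open>g\<close> shows that the index set is
      nonempty.\<close>
    then have "\<forall>x\<in>G. mdist euclidean_metric (?Z n \<omega> x) (?zero x) \<le> mdist (ell_infty G) (?Z n \<omega>) ?zero"
      using funspace_mdist_le[OF _ zero] g(1) by blast
    with g show "mdist (ell_infty G) (?Z n \<omega>) ?zero > K"
      by (fastforce simp: dist_real_def simp del: mdist_funspace)
  qed
  note sub = outer_measure_of_mono[OF this, of P]
  from K(2) have "\<forall>\<^sub>F n in sequentially. outer_measure_of P
      {\<omega> \<in> space P. \<exists>g\<in>G. \<bar>empirical_process Q X n \<omega> g\<bar> > K} \<le> ennreal \<epsilon>"
    by (rule eventually_mono) (rule order_trans[OF sub])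
  with \<open>K > 0\<close> show ?thesis
    by blast
qed

section \<open>Deterministic bounds on suprema and conditional means\<close>

lemma abs_sup0_le:
  assumes "\<And>y. y \<in> Y \<Longrightarrow> \<bar>y\<bar> \<le> c" and "0 \<le> c"
  shows "\<bar>sup0 Y\<bar> \<le> c"
  using assms cSup_abs_le[of Y c] by (auto simp: sup0_def)

lemma abs_set_integral_le:
  fixes f :: "'s \<Rightarrow> real"
  assumes "finite_measure N" and "integrable N f" and "A \<in> sets N"
    and "\<And>s. s \<in> space N \<Longrightarrow> \<bar>f s\<bar> \<le> C"
  shows "\<bar>LINT s|N. f s * indicator A s\<bar> \<le> C * measure N A"
proof -
  interpret finite_measure N by fact
  have int: "integrable N (\<lambda>s. f s * indicator A s)"
    using assms(2,3) by (simp add: integrable_real_mult_indicator)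
  have "\<bar>LINT s|N. f s * indicator A s\<bar> \<le> (LINT s|N. \<bar>f s * indicator A s\<bar>)"
    by simp
  also have "\<dots> \<le> (LINT s|N. C * indicator A s)"
  proof (intro integral_mono integrable_abs int)
    show "integrable N (\<lambda>s. C * indicator A s)"
      using assms(3) by (simp add: emeasure_eq_measure)
  qed (use assms(4) in \<open>auto simp: indicator_def\<close>)
  also have "\<dots> = C * measure N A"
    using sets.sets_into_space[OF assms(3)] by (simp add: Int_absorb2)
  finally show ?thesis .
qed

text \<open>The decomposition for two arbitrary measures, with \<open>M\<close> in the role of the
  empirical one. Only \<open>measure M A\<close> is divided by in the error term, so a lower bound
  on that number alone controls the denominator.\<close>

lemma cond_mean_diff_le:
  assumes "\<bar>(LINT s|M. f s * indicator A s) - (LINT s|N. f s * indicator A s)\<bar> \<le> \<delta>\<^sub>1"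
    and "\<bar>measure M A - measure N A\<bar> \<le> \<delta>\<^sub>2"
    and "\<bar>LINT s|N. f s * indicator A s\<bar> \<le> C * measure N A"
    and "0 \<le> C" and "0 < b" and "b \<le> measure M A"
  shows "\<bar>cond_mean M f A - cond_mean N f A\<bar> \<le> (\<delta>\<^sub>1 + C * \<delta>\<^sub>2) / b"
proof -
  define u v p q where "u = (LINT s|M. f s * indicator A s)"
    and "v = (LINT s|N. f s * indicator A s)" and "p = measure M A" and "q = measure N A"
  define e where "e = cond_mean N f A"
  have "0 < p" "0 \<le> q"
    using assms by (auto simp: p_def q_def)
  have M: "cond_mean M f A = u / p"
    using \<open>0 < p\<close> by (simp add: cond_mean_def u_def p_def set_lebesgue_integral_def mult.commute)
  have e: "e = (if q = 0 then 0 else v / q)"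
    by (simp add: e_def cond_mean_def v_def q_def set_lebesgue_integral_def mult.commute)
  have v: "\<bar>v\<bar> \<le> C * q"
    using assms(3) by (simp add: v_def q_def)
  have "e * q = v"
    using v by (auto simp: e)
  have "\<bar>e\<bar> \<le> C"
    using v \<open>0 \<le> q\<close> \<open>0 \<le> C\<close> by (auto simp: e abs_divide divide_le_eq)
  have "u / p - e = ((u - v) - e * (p - q)) / p"
    using \<open>0 < p\<close> by (simp add: field_simps flip: \<open>e * q = v\<close>)
  then have "\<bar>u / p - e\<bar> = \<bar>(u - v) - e * (p - q)\<bar> / p"
    using \<open>0 < p\<close> by (simp add: abs_divide)
  also have "\<dots> \<le> (\<delta>\<^sub>1 + C * \<delta>\<^sub>2) / b"
  proof (rule frac_le)
    have "\<bar>e * (p - q)\<bar> \<le> C * \<delta>\<^sub>2"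
      using \<open>\<bar>e\<bar> \<le> C\<close> assms(2) \<open>0 \<le> C\<close> by (auto simp: abs_mult p_def q_def intro!: mult_mono)
    moreover have "\<bar>u - v\<bar> \<le> \<delta>\<^sub>1"
      using assms(1) by (simp add: u_def v_def)
    ultimately show "\<bar>(u - v) - e * (p - q)\<bar> \<le> \<delta>\<^sub>1 + C * \<delta>\<^sub>2"
      by linarith
    then show "0 \<le> \<delta>\<^sub>1 + C * \<delta>\<^sub>2"
      by linarith
  qed (use assms in \<open>auto simp: p_def\<close>)
  finally show ?thesis
    by (simp add: M flip: e_def)
qed

text \<open>Undoing the factor \<open>sqrt n\<close> of the empirical process leaves errors
  \<open>K1 / sqrt n\<close> and \<open>K2 / sqrt n\<close>; dividing by the lower bound
  \<open>n powr (-\<alpha>)\<close> produces the rate.\<close>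

lemma empirical_cond_mean_diff_le:
  assumes Q: "prob_space Q" and f: "integrable Q f" and A: "A \<in> sets Q"
    and C: "\<And>s. s \<in> space Q \<Longrightarrow> \<bar>f s\<bar> \<le> C" "0 \<le> C"
    and n: "0 < n" and QnA: "real n powr (-\<alpha>) \<le> measure (empirical_measure Q X n \<omega>) A"
    and K1: "\<bar>empirical_process Q X n \<omega> (\<lambda>s. f s * indicator A s)\<bar> \<le> K1"
    and K2: "\<bar>empirical_process Q X n \<omega> (indicator A)\<bar> \<le> K2"
  shows "\<bar>cond_mean (empirical_measure Q X n \<omega>) f A - cond_mean Q f A\<bar>
           \<le> (K1 + C * K2) * real n powr (\<alpha> - 1/2)"
proof -
  interpret prob_space Q by fact
  let ?E = "empirical_measure Q X n \<omega>"
  have "A \<subseteq> space Q"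
    using A by (rule sets.sets_into_space)
  have scale: "\<bar>x\<bar> \<le> K / sqrt n" if "\<bar>sqrt n * x\<bar> \<le> K" for x K
    using that n by (simp add: abs_mult pos_le_divide_eq mult.commute)
  have "\<bar>(LINT s|?E. f s * indicator A s) - (LINT s|Q. f s * indicator A s)\<bar> \<le> K1 / sqrt n"
    using K1 by (intro scale) (simp add: empirical_process_def)
  moreover have "\<bar>measure ?E A - measure Q A\<bar> \<le> K2 / sqrt n"
    using K2 \<open>A \<subseteq> space Q\<close>
    by (intro scale) (simp add: empirical_process_def empirical_measure_def Int_absorb2)
  moreover have "\<bar>LINT s|Q. f s * indicator A s\<bar> \<le> C * measure Q A"
    using f A C finite_measure_axioms by (intro abs_set_integral_le) auto
  ultimately have "\<bar>cond_mean ?E f A - cond_mean Q f A\<bar>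
      \<le> (K1 / sqrt n + C * (K2 / sqrt n)) / real n powr (-\<alpha>)"
    using C n QnA by (intro cond_mean_diff_le) auto
  also have "\<dots> = (K1 + C * K2) * (real n powr \<alpha> / sqrt n)"
    using n by (simp add: powr_minus divide_simps distrib_right)
  also have "real n powr \<alpha> / sqrt n = real n powr (\<alpha> - 1/2)"
    using n by (simp add: powr_diff powr_half_sqrt)
  finally show ?thesis .
qed

section \<open>The rate in outer probability\<close>

theorem proposition3p2:
  fixes L \<alpha> :: real
    and Q :: "((real ^ 'd::finite) \<times> real) measure"
    and P :: "'w measure"
    and X :: "nat \<Rightarrow> 'w \<Rightarrow> (real ^ 'd) \<times> real"
    and F :: "((real ^ 'd) \<times> real \<Rightarrow> real) set"
    and B :: "((real ^ 'd) \<times> real) set set"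
  assumes "L > 0"
    and "prob_space Q"
    and "sets Q = sets (restrict_space borel (UNIV \<times> {-L..L}))"
    and "prob_space P"
    and "iid_sample P Q X"
    and "B \<subseteq> sets Q"
    and "\<forall>f\<in>F. integrable Q f"
    and "uniformly_bounded_on (space Q) F"
    and "donsker_sets P X Q B"
    and "donsker P X Q (restricted_class F B)"
    and "0 \<le> \<alpha>" and "\<alpha> < 1/2"
  shows "bigO_outer_prob P
           (\<lambda>n \<omega>. sup0 ((\<lambda>f. sup0 ((\<lambda>A.
                \<bar>cond_mean (empirical_measure Q X n \<omega>) f A - cond_mean Q f A\<bar>)
              ` {A \<in> B. measure (empirical_measure Q X n \<omega>) A \<ge> real n powr (-\<alpha>)})) ` F))
           (\<lambda>n. real n powr (\<alpha> - 1/2))"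
proof -
  let ?E = "\<lambda>n \<omega>. empirical_measure Q X n \<omega>"
  let ?M = "\<lambda>n \<omega>. sup0 ((\<lambda>f. sup0 ((\<lambda>A. \<bar>cond_mean (?E n \<omega>) f A - cond_mean Q f A\<bar>)
              ` {A \<in> B. measure (?E n \<omega>) A \<ge> real n powr (-\<alpha>)})) ` F)"
  let ?a = "\<lambda>n. real n powr (\<alpha> - 1/2)"
  obtain C0 where "\<forall>f\<in>F. \<forall>s\<in>space Q. \<bar>f s\<bar> \<le> C0"
    using assms by (auto simp: uniformly_bounded_on_def)
  \<comment> \<open>\<open>C0\<close> may be negative when \<open>F\<close> is empty; its absolute
    value serves as \<open>C\<close>.\<close>
  then obtain C where C: "\<And>f s. f \<in> F \<Longrightarrow> s \<in> space Q \<Longrightarrow> \<bar>f s\<bar> \<le> C" "0 \<le> C"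
    by (metis abs_ge_self abs_ge_zero order_trans)
  show ?thesis
    unfolding bigO_outer_prob_def
  proof (intro allI impI)
    fix \<epsilon> :: real assume "0 < \<epsilon>"
    let ?bad = "\<lambda>G K n. {\<omega> \<in> space P. \<exists>g\<in>G. \<bar>empirical_process Q X n \<omega> g\<bar> > K}"
    let ?G1 = "restricted_class F B" and ?G2 = "(\<lambda>A. indicator A :: _ \<Rightarrow> real) ` B"
    \<comment> \<open>Two events of outer probability at most \<open>\<epsilon>/3\<close> leave
      slack for the strict inequality on the limsup.\<close>
    obtain K1 where "K1 > 0"
      and K1: "\<forall>\<^sub>F n in sequentially. outer_measure_of P (?bad ?G1 K1 n) \<le> ennreal (\<epsilon>/3)"
      using donsker_bounded_in_outer_prob[of P X Q ?G1 "\<epsilon>/3"] assms \<open>0 < \<epsilon>\<close> by auto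
    obtain K2 where "K2 > 0"
      and K2: "\<forall>\<^sub>F n in sequentially. outer_measure_of P (?bad ?G2 K2 n) \<le> ennreal (\<epsilon>/3)"
      using donsker_bounded_in_outer_prob[of P X Q ?G2 "\<epsilon>/3"] assms \<open>0 < \<epsilon>\<close>
      unfolding donsker_sets_def by auto
    let ?K = "K1 + C * K2"
    have "0 < ?K"
      using \<open>K1 > 0\<close> \<open>K2 > 0\<close> C(2) by (simp add: add_pos_nonneg)
    \<comment> \<open>Off both bad events the bound holds pointwise and uniformly in
      \<open>f\<close> and \<open>A\<close>, so no measurability of the supremum enters.\<close>
    have good: "\<bar>?M n \<omega>\<bar> / ?a n \<le> ?K"
      if "0 < n" and \<omega>: "\<omega> \<in> space P" "\<omega> \<notin> ?bad ?G1 K1 n" "\<omega> \<notin> ?bad ?G2 K2 n" for n \<omega>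
    proof -
      have "\<bar>cond_mean (?E n \<omega>) f A - cond_mean Q f A\<bar> \<le> ?K * ?a n"
        if "f \<in> F" "A \<in> B" "real n powr (-\<alpha>) \<le> measure (?E n \<omega>) A" for f A
      proof (rule empirical_cond_mean_diff_le)
        have "(\<lambda>s. f s * indicator A s) \<in> ?G1"
          using that by (auto simp: restricted_class_def)
        then show "\<bar>empirical_process Q X n \<omega> (\<lambda>s. f s * indicator A s)\<bar> \<le> K1"
          using \<omega> by (auto simp: not_less)
        show "\<bar>empirical_process Q X n \<omega> (indicator A)\<bar> \<le> K2"
          using \<omega> that by (auto simp: not_less)
      qed (use that assms C \<open>0 < n\<close> in auto)
      \<comment> \<open>\<open>abs_sup0_le\<close> serves both the inner and the outer supremum; the
        bound is nonnegative, which covers empty index sets.\<close>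
      then have "\<bar>?M n \<omega>\<bar> \<le> ?K * ?a n"
        using \<open>0 < ?K\<close> by (auto intro!: abs_sup0_le)
      then show ?thesis
        \<comment> \<open>Positivity of \<open>n\<close> makes the rate positive; at
          \<open>n = 0\<close> the \<open>powr\<close> term would be 0.\<close>
        using \<open>0 < n\<close> by (simp add: divide_le_eq)
    qed
    have "\<forall>\<^sub>F n in sequentially.
        outer_measure_of P {\<omega> \<in> space P. \<bar>?M n \<omega>\<bar> / ?a n > ?K} \<le> ennreal (\<epsilon>/3 + \<epsilon>/3)"
      using K1 K2 eventually_gt_at_top[of 0]
    proof eventually_elim
      case (elim n)
      have "outer_measure_of P {\<omega> \<in> space P. \<bar>?M n \<omega>\<bar> / ?a n > ?K}
          \<le> outer_measure_of P (?bad ?G1 K1 n \<union> ?bad ?G2 K2 n)"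
      proof (intro outer_measure_of_mono subsetI)
        fix \<omega> assume "\<omega> \<in> {\<omega> \<in> space P. \<bar>?M n \<omega>\<bar> / ?a n > ?K}"
        then have "\<omega> \<in> space P" "\<not> \<bar>?M n \<omega>\<bar> / ?a n \<le> ?K"
          by (simp_all only: mem_Collect_eq not_le)
        then show "\<omega> \<in> ?bad ?G1 K1 n \<union> ?bad ?G2 K2 n"
          using good[OF elim(3)] by blast
      qed
      also have "\<dots> \<le> outer_measure_of P (?bad ?G1 K1 n) + outer_measure_of P (?bad ?G2 K2 n)"
        by (rule outer_measure_of_Un_le)
      also have "\<dots> \<le> ennreal (\<epsilon>/3) + ennreal (\<epsilon>/3)"
        using elim(1,2) by (rule add_mono)
      also have "\<dots> = ennreal (\<epsilon>/3 + \<epsilon>/3)"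
        using \<open>0 < \<epsilon>\<close> by (intro ennreal_plus[symmetric]) auto
      finally show ?case .
    qed
    then have "limsup (\<lambda>n. outer_measure_of P {\<omega> \<in> space P. \<bar>?M n \<omega>\<bar> / ?a n > ?K})
        \<le> ennreal (\<epsilon>/3 + \<epsilon>/3)"
      by (rule Limsup_bounded)
    also have "\<dots> < ennreal \<epsilon>"
      using \<open>0 < \<epsilon>\<close> by (intro ennreal_lessI) auto
    finally show "\<exists>K>0. limsup (\<lambda>n. outer_measure_of P
        {\<omega> \<in> space P. \<bar>?M n \<omega>\<bar> / ?a n > K}) < ennreal \<epsilon>"
      using \<open>0 < ?K\<close> by blast
  qed
qed

end
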